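(* Let $j$ be an odd positive integer and let $(G_n)_{n\ge0}$ satisfy $G_n=G_{n-1}+G_{n-2}$ for $n\ge2$ with $G_0,G_1\in\mathbb{Z}$ relatively prime. Then the $j$-th Lucas number satisfies $L_j=\mathcal{G}_{G_0,G_1}(2j)$; more precisely, $$L_j=\gcd(G_{2j+1}-G_1,\;G_{2j+2}-G_2).$$
   Context: $L_n$ are the Lucas numbers ($L_0=2$, $L_1=1$, $L_n=L_{n-1}+L_{n-2}$). $\mathcal{G}_{G_0,G_1}(k)$ is the greatest common divisor of all integers $\sum_{i=0}^{k-1}G_{n+i}$, $n\ge1$. *)

theory Defs
  imports Main
begin

fun lucas :: "nat \<Rightarrow> nat" where
  "lucas 0 = 2"
| "lucas (Suc 0) = 1"
| "lucas (Suc (Suc n)) = lucas (Suc n) + lucas n"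

text \<open>
  The sequence \<open>G\<close> itself is the argument here; for a sequence with
  \<open>G (n + 2) = G (n + 1) + G n\<close> this depends only on the initial values \<open>G 0\<close>, \<open>G 1\<close>.
  The sums start at an index \<open>n \<ge> 1\<close>, so \<open>G 0\<close> never occurs as a summand.
\<close>

definition gcd_consecutive_sums :: "(nat \<Rightarrow> int) \<Rightarrow> nat \<Rightarrow> int" where
  "gcd_consecutive_sums G k = Gcd {(\<Sum>i<k. G (n + i)) |n. n \<ge> 1}"

end

theory Submission
  imports Defs
begin

text \<open>
  For odd \<open>j\<close> one has \<open>G (m + 2j) - G m = L\<^sub>j G (m + j)\<close>, and \<open>2j\<close> consecutive terms starting at
  \<open>n\<close> telescope to \<open>G (n + 2j + 1) - G (n + 1)\<close>. So both gcds are \<open>L\<^sub>j\<close> times a gcd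
  of terms of \<open>G\<close> that include two consecutive ones, and consecutive terms are coprime.
\<close>

text \<open>Applying the cases \<open>j + 1\<close> and \<open>j\<close> at the starts
  \<open>m + 1\<close> and \<open>m + 2\<close> gives both products the same factor
  \<open>G (m + j + 2)\<close>. Their signs are opposite, so the remainders combine to
  \<open>G (m + 2) - G (m + 1) = G m\<close>.\<close>

lemma lucas_mult_eq:
  fixes G :: "nat \<Rightarrow> int"
  assumes "\<And>n. G (n + 2) = G (n + 1) + G n"
  shows "int (lucas j) * G (m + j) = G (m + 2 * j) + (-1) ^ j * G m"
proof (induction j arbitrary: m rule: lucas.induct)
  case 1
  show ?case by simp
next
  case 2
  show ?case using assms[of m] by simp
next
  case (3 j)
  have "int (lucas (Suc (Suc j))) * G (m + Suc (Suc j))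
      = int (lucas (Suc j)) * G (Suc m + Suc j) + int (lucas j) * G (m + 2 + j)"
    by (simp add: algebra_simps)
  also have "\<dots> = G (Suc m + 2 * Suc j) + G (m + 2 + 2 * j) + (-1) ^ j * (G (m + 2) - G (Suc m))"
    unfolding "3.IH" by (simp add: algebra_simps)
  also have "G (m + 2) - G (Suc m) = G m"
    using assms[of m] by simp
  also have "G (Suc m + 2 * Suc j) + G (m + 2 + 2 * j) = G (m + 2 * Suc (Suc j))"
    using assms[of "m + 2 + 2 * j"] by (simp add: algebra_simps eval_nat_numeral)
  finally show ?case by simp
qed

lemma sum_consecutive_eq_diff:
  fixes G :: "nat \<Rightarrow> int"
  assumes "\<And>n. G (n + 2) = G (n + 1) + G n"
  shows "(\<Sum>i<k. G (n + i)) = G (n + 1 + k) - G (n + 1)"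
proof (induction k)
  case (Suc k)
  then show ?case using assms[of "n + k"] by simp
qed simp

text \<open>A step of the Euclidean algorithm: adding \<open>G (n + 1)\<close> to \<open>G n\<close>
  does not change the gcd with \<open>G (n + 1)\<close>.\<close>

lemma coprime_consecutive:
  fixes G :: "nat \<Rightarrow> int"
  assumes "\<And>n. G (n + 2) = G (n + 1) + G n" and "coprime (G 0) (G 1)"
  shows "coprime (G n) (G (n + 1))"
proof (induction n)
  case (Suc n)
  then show ?case
    using assms(1)[of n] by (simp add: coprime_iff_gcd_eq_1 gcd.commute)
qed (use assms(2) in simp)

theorem theorem6p10:
  fixes G :: "nat \<Rightarrow> int" and j :: nat
  assumes "odd j"
    and "\<And>n. n \<ge> 2 \<Longrightarrow> G n = G (n - 1) + G (n - 2)"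
    and "coprime (G 0) (G 1)"
  shows "int (lucas j) = gcd_consecutive_sums G (2 * j)
       \<and> int (lucas j) = gcd (G (2 * j + 1) - G 1) (G (2 * j + 2) - G 2)"
proof
  let ?L = "int (lucas j)"
  have rec: "G (n + 2) = G (n + 1) + G n" for n
    using assms(2)[of "n + 2"] by simp
  \<comment> \<open>Oddness of \<open>j\<close> makes the sign \<open>(-1) ^ j\<close> equal to
    -1.\<close>
  have diff: "G (m + 2 * j) - G m = ?L * G (m + j)" for m
    using lucas_mult_eq[of G j m, OF rec] \<open>odd j\<close> by simp
  have gcd_L: "gcd (?L * G m) (?L * G (m + 1)) = ?L" for m
    using coprime_consecutive[of G m, OF rec assms(3)]
    by (simp add: gcd_mult_left coprime_iff_gcd_eq_1)
  let ?S = "{(\<Sum>i<2 * j. G (n + i)) |n. n \<ge> 1}"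
  have sum_L: "(\<Sum>i<2 * j. G (n + i)) = ?L * G (n + 1 + j)" for n
    using sum_consecutive_eq_diff[of G n "2 * j", OF rec] diff[of "n + 1"] by simp
  have "Gcd ?S = ?L"
  proof (rule zdvd_antisym_nonneg)
    have mem: "?L * G (n + 1 + j) \<in> ?S" if "n \<ge> 1" for n
      using that sum_L[of n] by force
    \<comment> \<open>The sums starting at 1 and 2 suffice: they are \<open>?L\<close> times the
      consecutive terms of index \<open>j + 2\<close> and \<open>j + 3\<close>.\<close>
    have "Gcd ?S dvd gcd (?L * G (1 + 1 + j)) (?L * G (2 + 1 + j))"
      using mem[of 1] mem[of 2] by (intro gcd_greatest Gcd_dvd) auto
    then show "Gcd ?S dvd ?L"
      using gcd_L[of "1 + 1 + j"] by (simp add: eval_nat_numeral del: gcd_greatest_iff)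
    show "?L dvd Gcd ?S"
      by (rule Gcd_greatest) (auto simp: sum_L)
  qed simp_all
  then show "?L = gcd_consecutive_sums G (2 * j)"
    by (simp add: gcd_consecutive_sums_def)
  show "?L = gcd (G (2 * j + 1) - G 1) (G (2 * j + 2) - G 2)"
    \<comment> \<open>The two differences are \<open>?L * G (j + 1)\<close> and
      \<open>?L * G (j + 2)\<close>.\<close>
    using diff[of 1] diff[of 2] gcd_L[of "j + 1"] by (simp add: add.commute)
qed

end
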